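(* Let $\overline{x}\in\mathbb{R}^n$. Suppose: (i) $F:\mathbb{R}^n\rightrightarrows\mathbb{R}^n$ is upper semicontinuous with nonempty compact values; (ii) $f:\mathbb{R}^n\to\mathbb{R}$ is a (locally Lipschitz) potential of a conservative field $D:\mathbb{R}^n\rightrightarrows\mathbb{R}^n$ such that for every $\widehat{x}\in\mathbb{R}^n$ there exist $\rho\in(0,\infty)$ and $\kappa\in\mathcal{P}$ such that $$\forall x\in B_\rho(\widehat{x}),\quad \max_{u\in\mathrm{co}\,F(x)}\ \min_{v\in D(x)}\langle u,v\rangle\leq-\min_{w\in D(x)}\kappa(w),$$ and $f(\overline{x})$ is an isolated $D$-critical value of $f$; (iii) $g:\mathbb{R}^n\to\mathbb{R}\cup\{\infty\}$ is continuous and d-Lyapunov near $\overline{x}$ (for $F$); (iv) $\overline{x}$ is a strict local minimum of $f+g$. Then $\overline{x}$ is d-stable for $F$.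
   Context: $|\cdot|=\sqrt{\langle\cdot,\cdot\rangle}$ is the Euclidean norm, $B_r(\overline{x})$ is the open ball of radius $r$ centered at $\overline{x}$, $\mathrm{co}$ is the convex hull, $\mathbb{N}=\{0,1,2,\dots\}$. $F$ is upper semicontinuous if for every $x$ and every neighborhood $V$ of $F(x)$ there is a neighborhood $U$ of $x$ with $F(U)=\bigcup_{y\in U}F(y)\subseteq V$. $\mathcal{P}$ is the set of continuous functions $\kappa:\mathbb{R}^n\to\mathbb{R}$ with $\kappa(0)=0$ and $\kappa(x)>0$ for all $x\neq0$. Conservative field: given a locally Lipschitz function $f:\mathbb{R}^n\to\mathbb{R}$, a set-valued map $D:\mathbb{R}^n\rightrightarrows\mathbb{R}^n$ is a conservative field for $f$ (and $f$ is called a potential of $D$) if $D$ has a closed graph, nonempty compact values, and for every absolutely continuous curve $x:[0,1]\to\mathbb{R}^n$, for almost every $t\in(0,1)$ and for all $v\in D(x(t))$, $(f\circ x)'(t)=\langle v,x'(t)\rangle$. A scalar $\ell$ is a $D$-critical value of $f$ if there exists $x\in\mathbb{R}^n$ with $\ell=f(x)$ and $0\in D(x)$; it is isolated if it is an isolated point of the set of $D$-critical values of $f$. d-Lyapunov: $g:\mathbb{R}^n\to\mathbb{R}\cup\{\infty\}$ is d-Lyapunov on $U\subseteq\mathbb{R}^n$ if there exists $\overline{\alpha}>0$ such that for all $\{\alpha_k\}_{k\in\mathbb{N}}\subseteq(0,\overline{\alpha}]$, all sequences $\{x_k\}_{k\in\mathbb{N}}$ with $x_{k+1}\in x_k+\alpha_kF(x_k)$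 for all $k$, and all $k\in\mathbb{N}$: $x_k\in U\Rightarrow g(x_{k+1})\leq g(x_k)$. "Continuous and d-Lyapunov near $\overline{x}$" means on some neighborhood of $\overline{x}$. d-stable: $\overline{x}$ is d-stable for $F$ if for every $\epsilon>0$ there exist $\delta,\overline{\alpha}>0$ such that for all $\{\alpha_k\}_{k\in\mathbb{N}}\subseteq(0,\overline{\alpha}]$ and all $\{x_k\}_{k\in\mathbb{N}}\subseteq\mathbb{R}^n$ with $x_{k+1}\in x_k+\alpha_kF(x_k)$ for all $k\in\mathbb{N}$: $x_0\in B_\delta(\overline{x})\Rightarrow\{x_k\}_{k\in\mathbb{N}}\subseteq B_\epsilon(\overline{x})$. *)

theory Defs
  imports "HOL-Analysis.Analysis"
begin

definition locally_lipschitz :: "('a::metric_space \<Rightarrow> 'b::metric_space) \<Rightarrow> bool" where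
  "locally_lipschitz f \<longleftrightarrow> (\<forall>x. \<exists>e>0. \<exists>L. L-lipschitz_on (ball x e) f)"

definition upper_semicontinuous_map :: "('a::topological_space \<Rightarrow> 'b::topological_space set) \<Rightarrow> bool" where
  "upper_semicontinuous_map F \<longleftrightarrow>
     (\<forall>x V. open V \<and> F x \<subseteq> V \<longrightarrow> (\<exists>U. open U \<and> x \<in> U \<and> (\<Union>y\<in>U. F y) \<subseteq> V))"

text \<open>The class of gauge functions called \<open>\<P>\<close> in the literature.\<close>

definition pos_def_funs :: "('a::euclidean_space \<Rightarrow> real) set" where
  "pos_def_funs = {\<kappa>. continuous_on UNIV \<kappa> \<and> \<kappa> 0 = 0 \<and> (\<forall>x. x \<noteq> 0 \<longrightarrow> \<kappa> x > 0)}"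

text \<open>Absolute continuity of a curve on a set of reals, in the \<open>\<epsilon>\<close>-\<open>\<delta>\<close> sense.  This is unrelated to
  \<^const>\<open>absolutely_continuous\<close>, which is a relation between measures.  A pair \<open>(a, b) \<in> P\<close> stands
  for the interval from \<open>a\<close> to \<open>b\<close>; the intervals may share endpoints only.\<close>

definition absolutely_continuous_curve_on :: "real set \<Rightarrow> (real \<Rightarrow> 'a::real_normed_vector) \<Rightarrow> bool" where
  "absolutely_continuous_curve_on S x \<longleftrightarrow>
     (\<forall>\<epsilon>>0. \<exists>\<delta>>0. \<forall>P::(real \<times> real) set.
        finite P \<longrightarrow>
        (\<forall>(a, b)\<in>P. a < b \<and> {a..b} \<subseteq> S) \<longrightarrow>
        pairwise (\<lambda>(a, b) (c, d). disjnt {a<..<b} {c<..<d}) P \<longrightarrow>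
        (\<Sum>(a, b)\<in>P. b - a) < \<delta> \<longrightarrow>
        (\<Sum>(a, b)\<in>P. norm (x b - x a)) < \<epsilon>)"

text \<open>The existence of both derivatives in the chain rule is part of the equation
  \<open>(f \<circ> x)'(t) = \<langle>v, x'(t)\<rangle>\<close>; for locally Lipschitz \<open>f\<close> and absolutely continuous \<open>x\<close> it is automatic
  for almost every \<open>t\<close>.  The exceptional null set depends on the curve, but not on \<open>v\<close>.\<close>

definition conservative_field ::
    "('a::euclidean_space \<Rightarrow> 'a set) \<Rightarrow> ('a \<Rightarrow> real) \<Rightarrow> bool" where
  "conservative_field D f \<longleftrightarrow>
     locally_lipschitz f \<and>
     closed {(x, v). v \<in> D x} \<and>
     (\<forall>x. D x \<noteq> {} \<and> compact (D x)) \<and>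
     (\<forall>x::real \<Rightarrow> 'a. absolutely_continuous_curve_on {0..1} x \<longrightarrow>
        (AE t in lebesgue. t \<in> {0<..<1} \<longrightarrow>
           (\<exists>x'. (x has_vector_derivative x') (at t) \<and>
              (\<forall>v\<in>D (x t). ((f \<circ> x) has_real_derivative (v \<bullet> x')) (at t)))))"

definition critical_values :: "('a::zero \<Rightarrow> 'a set) \<Rightarrow> ('a \<Rightarrow> real) \<Rightarrow> real set" where
  "critical_values D f = {f x | x. 0 \<in> D x}"

text \<open>Sequences with \<open>x\<^sub>k\<^sub>+\<^sub>1 \<in> x\<^sub>k + \<alpha>\<^sub>k F(x\<^sub>k)\<close>.\<close>

definition discrete_trajectory ::
    "('a::real_vector \<Rightarrow> 'a set) \<Rightarrow> (nat \<Rightarrow> real) \<Rightarrow> (nat \<Rightarrow> 'a) \<Rightarrow> bool" where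
  "discrete_trajectory F \<alpha> x \<longleftrightarrow> (\<forall>k. x (Suc k) \<in> (\<lambda>u. x k + \<alpha> k *\<^sub>R u) ` F (x k))"

definition d_lyapunov_on ::
    "'a::real_vector set \<Rightarrow> ('a \<Rightarrow> 'a set) \<Rightarrow> ('a \<Rightarrow> ereal) \<Rightarrow> bool" where
  "d_lyapunov_on U F g \<longleftrightarrow>
     (\<exists>\<alpha>max>0. \<forall>\<alpha> x. range \<alpha> \<subseteq> {0<..\<alpha>max} \<longrightarrow> discrete_trajectory F \<alpha> x \<longrightarrow>
        (\<forall>k. x k \<in> U \<longrightarrow> g (x (Suc k)) \<le> g (x k)))"

definition d_stable :: "('a::real_normed_vector \<Rightarrow> 'a set) \<Rightarrow> 'a \<Rightarrow> bool" where
  "d_stable F xbar \<longleftrightarrow>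
     (\<forall>\<epsilon>>0. \<exists>\<delta>>0. \<exists>\<alpha>max>0. \<forall>\<alpha> x.
        range \<alpha> \<subseteq> {0<..\<alpha>max} \<longrightarrow> discrete_trajectory F \<alpha> x \<longrightarrow>
        x 0 \<in> ball xbar \<delta> \<longrightarrow> range x \<subseteq> ball xbar \<epsilon>)"

definition strict_local_minimum :: "('a::topological_space \<Rightarrow> 'b::linorder) \<Rightarrow> 'a \<Rightarrow> bool" where
  "strict_local_minimum h xbar \<longleftrightarrow>
     (\<exists>U. open U \<and> xbar \<in> U \<and> (\<forall>x\<in>U - {xbar}. h xbar < h x))"

text \<open>The inequality \<open>max\<^sub>u min\<^sub>v \<langle>u, v\<rangle> \<le> - min\<^sub>w \<kappa>(w)\<close>, with \<open>u\<close> ranging over the convex hull of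
  \<open>A\<close> and \<open>v, w\<close> over \<open>B\<close>.  It is meant for nonempty compact \<open>A\<close>, \<open>B\<close> and continuous \<open>\<kappa>\<close>: then all
  suprema and infima below are over bounded nonempty sets and are attained, hence are the maxima
  and minima (\<^const>\<open>Max\<close> and \<^const>\<open>Min\<close> are for finite sets only).\<close>

definition max_min_descent ::
    "'a::euclidean_space set \<Rightarrow> 'a set \<Rightarrow> ('a \<Rightarrow> real) \<Rightarrow> bool" where
  "max_min_descent A B \<kappa> \<longleftrightarrow>
     (SUP u\<in>convex hull A. INF v\<in>B. u \<bullet> v) \<le> - (INF w\<in>B. \<kappa> w)"

end

theory Submission
  imports Defs "HOL-Complex_Analysis.Great_Picard"
begin

text \<open>Choose a noncritical level \<open>c\<close> slightly above \<open>f xbar\<close>.  For small steps, a trajectory that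
  starts at a level below \<open>c\<close> cannot climb noticeably above \<open>c\<close> while it stays in a compact set:
  otherwise a limit of polygonal interpolations would be a curve with velocities in the convex hull
  of \<open>F\<close> on which \<open>f\<close> stays at the noncritical level \<open>c\<close>.  Together with the monotonicity of \<open>g\<close>,
  this keeps \<open>f + g\<close> below its minimum over an annulus around its strict minimizer \<open>xbar\<close>, and short steps cannot jump across that annulus.\<close>

section \<open>Monotonicity from the sign of an almost everywhere derivative\<close>

text \<open>A Lipschitz function maps the exceptional null set to a null set, so if \<open>\<phi>\<close>, slightly tilted,
  increased from \<open>a\<close> to \<open>b\<close>, it would leave some intermediate level for the last time at a point
  with negative derivative.\<close>

lemma lipschitz_deriv_nonpos_imp_le:
  fixes \<phi> :: "real \<Rightarrow> real"
  assumes "a \<le> b" and lip: "L-lipschitz_on {a..b} \<phi>" and N: "negligible N"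
    and der: "\<And>t. t \<in> {a<..<b} - N \<Longrightarrow> \<exists>d\<le>0. (\<phi> has_real_derivative d) (at t)"
  shows "\<phi> b \<le> \<phi> a"
proof (rule ccontr)
  assume "\<not> \<phi> b \<le> \<phi> a"
  then have less: "\<phi> a < \<phi> b" by simp
  with \<open>a \<le> b\<close> have "a < b" by (cases "a = b") auto
  \<comment> \<open>Half the mean slope of \<open>\<phi>\<close>: the tilted function still
    increases from \<open>a\<close> to \<open>b\<close>, while its derivative off \<open>N\<close>
    becomes strictly negative.\<close>
  define e where "e = (\<phi> b - \<phi> a) / (2 * (b - a))"
  have "e > 0" using less \<open>a < b\<close> by (simp add: e_def)
  define \<psi> where "\<psi> t = \<phi> t - e * (t - a)" for t
  have "\<psi> b - \<psi> a = (\<phi> b - \<phi> a) / 2"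
    using \<open>a < b\<close> by (simp add: \<psi>_def e_def field_simps)
  then have \<psi>_less: "\<psi> a < \<psi> b" using less by simp
  have \<psi>_lip: "\<bar>\<psi> s - \<psi> t\<bar> \<le> (L + e) * \<bar>s - t\<bar>" if "s \<in> {a..b}" "t \<in> {a..b}" for s t
  proof -
    have "\<bar>\<phi> s - \<phi> t\<bar> \<le> L * \<bar>s - t\<bar>"
      using lipschitz_onD[OF lip that] by (simp add: dist_real_def)
    moreover have "\<psi> s - \<psi> t = (\<phi> s - \<phi> t) - e * (s - t)" by (simp add: \<psi>_def algebra_simps)
    moreover have "\<bar>e * (s - t)\<bar> = e * \<bar>s - t\<bar>" using \<open>e > 0\<close> by (simp add: abs_mult)
    ultimately have "\<bar>\<psi> s - \<psi> t\<bar> \<le> L * \<bar>s - t\<bar> + e * \<bar>s - t\<bar>" by linarith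
    then show ?thesis by (simp add: distrib_right)
  qed
  have cont: "continuous_on {a..b} \<psi>"
    unfolding \<psi>_def by (intro continuous_intros lipschitz_on_continuous_on[OF lip])
  have "negligible (\<psi> ` (N \<inter> {a..b}))"
  proof (rule negligible_locally_Lipschitz_image)
    show "negligible (N \<inter> {a..b})" using N by (simp add: negligible_Int)
    fix t assume "t \<in> N \<inter> {a..b}"
    then show "\<exists>T B. open T \<and> t \<in> T \<and>
        (\<forall>s \<in> (N \<inter> {a..b}) \<inter> T. norm (\<psi> s - \<psi> t) \<le> B * norm (s - t))"
      using \<psi>_lip by (intro exI[of _ UNIV] exI[of _ "L + e"]) auto
  qed simp
  moreover have "\<not> negligible {\<psi> a<..<\<psi> b}"
    using \<psi>_less open_not_negligible[of "{\<psi> a<..<\<psi> b}"] by (auto simp: not_le)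
  ultimately obtain y where y: "\<psi> a < y" "y < \<psi> b" "y \<notin> \<psi> ` (N \<inter> {a..b})"
    by (metis greaterThanLessThan_iff negligible_subset subsetI)
  let ?S = "{a..b} \<inter> \<psi> -` {..y}"
  have "compact ?S"
    by (meson bounded_Int bounded_closed_interval closed_atMost closed_real_atLeastAtMost
        compact_eq_bounded_closed cont continuous_closed_preimage)
  moreover have "a \<in> ?S" using \<open>a < b\<close> y by simp
  ultimately obtain t where t: "t \<in> ?S" and t_max: "\<And>s. s \<in> ?S \<Longrightarrow> s \<le> t"
    by (metis compact_attains_sup empty_iff)
  \<comment> \<open>Level \<open>y\<close> is attained at some \<open>s\<close> in
    \<open>{t..b}\<close>. Such an \<open>s\<close> lies in \<open>?S\<close>, so maximality of
    \<open>t\<close> forces \<open>s = t\<close>.\<close>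
  have "continuous_on {t..b} \<psi>" using t by (auto intro: continuous_on_subset[OF cont])
  then obtain s where "t \<le> s" "s \<le> b" "\<psi> s = y"
    using IVT'[of \<psi> t y b] t y by auto
  then have \<psi>t: "\<psi> t = y"
    using t_max[of s] t by force
  then have "t \<noteq> a" "t \<noteq> b" "t \<notin> N" using y t by auto
  then have "t \<in> {a<..<b} - N" using t by auto
  then obtain d where "d \<le> 0" "(\<phi> has_real_derivative d) (at t)" using der by blast
  then have "(\<psi> has_real_derivative d - e) (at t)"
    unfolding \<psi>_def by (auto intro!: derivative_eq_intros)
  moreover have "d - e < 0" using \<open>d \<le> 0\<close> \<open>e > 0\<close> by simp
  ultimately obtain r where r: "r > 0" "\<And>h. 0 < h \<Longrightarrow> h < r \<Longrightarrow> \<psi> (t + h) < \<psi> t"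
    using DERIV_neg_dec_right by blast
  define h where "h = min (r / 2) (b - t)"
  have h: "0 < h" "h < r" "t + h \<le> b"
    using r \<open>t \<in> {a<..<b} - N\<close> by (auto simp: h_def)
  then have "t + h \<in> ?S" using r(2)[of h] \<psi>t t by auto
  then show False using t_max[of "t + h"] h by simp
qed

section \<open>Polygonal interpolation of Euler paths\<close>

text \<open>If \<open>t\<close> is the time elapsed since an edge began and \<open>a\<close> its
  duration, this is the time already spent on that edge.\<close>

definition clip :: "real \<Rightarrow> real \<Rightarrow> real" where
  "clip t a = max 0 (min t a)"

text \<open>The edges occupy consecutive time intervals, so the times spent on them add up to the
  time spent on their union.\<close>

lemma sum_clip:
  fixes \<alpha> :: "nat \<Rightarrow> real"
  assumes "\<And>k. k < N \<Longrightarrow> 0 \<le> \<alpha> k"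
  shows "(\<Sum>k<N. clip (t - sum \<alpha> {..<k}) (\<alpha> k)) = clip t (sum \<alpha> {..<N})"
  using assms
proof (induction N)
  case (Suc N)
  have "0 \<le> sum \<alpha> {..<N}" using Suc.prems by (intro sum_nonneg) auto
  moreover have "0 \<le> \<alpha> N" using Suc.prems by simp
  moreover have "(\<Sum>k<N. clip (t - sum \<alpha> {..<k}) (\<alpha> k)) = clip t (sum \<alpha> {..<N})"
    using Suc by simp
  ultimately show ?case by (auto simp: clip_def)
qed (auto simp: clip_def)

text \<open>The condition is put on the quotients because they are the edge velocities of the
  interpolating polygon. \<open>K\<close> will be a compact set, which bounds them
  uniformly.\<close>

definition euler_path ::
    "('a::real_vector \<Rightarrow> 'a set) \<Rightarrow> 'a set \<Rightarrow> real \<Rightarrow> nat \<Rightarrow> (nat \<Rightarrow> real) \<Rightarrow> (nat \<Rightarrow> 'a) \<Rightarrow> bool" where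
  "euler_path F K h N \<alpha> x \<longleftrightarrow> (\<forall>k<N. 0 < \<alpha> k \<and> \<alpha> k \<le> h \<and> (x (Suc k) - x k) /\<^sub>R \<alpha> k \<in> F (x k))
     \<and> (\<forall>k\<le>N. x k \<in> K)"

text \<open>Writing the polygonal interpolation of the nodes \<open>x 0, \<dots>, x N\<close> with a clipped time spent
  on each edge makes its increments weighted sums of the edge velocities.\<close>

definition polygon :: "nat \<Rightarrow> (nat \<Rightarrow> real) \<Rightarrow> (nat \<Rightarrow> 'a::real_vector) \<Rightarrow> real \<Rightarrow> 'a" where
  "polygon N \<alpha> x t =
     x 0 + (\<Sum>k<N. clip (t - sum \<alpha> {..<k}) (\<alpha> k) *\<^sub>R ((x (Suc k) - x k) /\<^sub>R \<alpha> k))"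

text \<open>At a node time every earlier edge is fully traversed and no later one has begun, so the
  sum telescopes.\<close>

lemma polygon_node:
  assumes pos: "\<And>k. k < N \<Longrightarrow> 0 < \<alpha> k" and "m \<le> N"
  shows "polygon N \<alpha> x (sum \<alpha> {..<m}) = x m"
proof -
  have mono: "sum \<alpha> {..<i} \<le> sum \<alpha> {..<j}" if "i \<le> j" "j \<le> N" for i j
    using that pos by (intro sum_mono2) (auto intro: less_imp_le)
  have "(\<Sum>k<N. clip (sum \<alpha> {..<m} - sum \<alpha> {..<k}) (\<alpha> k) *\<^sub>R ((x (Suc k) - x k) /\<^sub>R \<alpha> k))
      = (\<Sum>k<N. if k < m then x (Suc k) - x k else 0)"
  proof (rule sum.cong)
    fix k assume k: "k \<in> {..<N}"
    show "clip (sum \<alpha> {..<m} - sum \<alpha> {..<k}) (\<alpha> k) *\<^sub>R ((x (Suc k) - x k) /\<^sub>R \<alpha> k)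
        = (if k < m then x (Suc k) - x k else 0)"
    proof (cases "k < m")
      case True
      then have "clip (sum \<alpha> {..<m} - sum \<alpha> {..<k}) (\<alpha> k) = \<alpha> k"
        using mono[of "Suc k" m] \<open>m \<le> N\<close> pos[of k] k by (auto simp: clip_def)
      then show ?thesis using True pos[of k] k by simp
    next
      case False
      then have "clip (sum \<alpha> {..<m} - sum \<alpha> {..<k}) (\<alpha> k) = 0"
        using mono[of m k] k by (auto simp: clip_def)
      then show ?thesis using False by simp
    qed
  qed simp
  also have "\<dots> = (\<Sum>k<m. x (Suc k) - x k)"
    using \<open>m \<le> N\<close> by (simp add: sum.If_cases) (metis Int_absorb1 lessThan_def lessThan_subset_iff)
  finally show ?thesis by (simp add: polygon_def sum_lessThan_telescope)
qed

text \<open>The increment is a sum of edge velocities with nonnegative weights, which vanish for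
  edges finished by time \<open>s\<close> or not begun by time \<open>t\<close>. By
  \<open>sum_clip\<close> the weights add up to the last factor.\<close>

lemma inner_polygon_diff_le:
  assumes pos: "\<And>k. k < N \<Longrightarrow> 0 < \<alpha> k" and "s \<le> t"
    and bound: "\<And>k. k < N \<Longrightarrow> sum \<alpha> {..<k} < t \<Longrightarrow> s < sum \<alpha> {..<Suc k} \<Longrightarrow>
       a \<bullet> ((x (Suc k) - x k) /\<^sub>R \<alpha> k) \<le> b"
  shows "a \<bullet> (polygon N \<alpha> x t - polygon N \<alpha> x s)
    \<le> b * (clip t (sum \<alpha> {..<N}) - clip s (sum \<alpha> {..<N}))"
proof -
  let ?u = "\<lambda>k. (x (Suc k) - x k) /\<^sub>R \<alpha> k"
  let ?w = "\<lambda>k. clip (t - sum \<alpha> {..<k}) (\<alpha> k) - clip (s - sum \<alpha> {..<k}) (\<alpha> k)"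
  have "a \<bullet> (polygon N \<alpha> x t - polygon N \<alpha> x s) = (\<Sum>k<N. ?w k * (a \<bullet> ?u k))"
    unfolding polygon_def
    by (simp add: inner_diff_right inner_sum_right inner_add_right sum_subtractf[symmetric]
        left_diff_distrib mult.assoc)
  also have "\<dots> \<le> (\<Sum>k<N. ?w k * b)"
  proof (rule sum_mono)
    fix k assume k: "k \<in> {..<N}"
    show "?w k * (a \<bullet> ?u k) \<le> ?w k * b"
    proof (cases "sum \<alpha> {..<k} < t \<and> s < sum \<alpha> {..<Suc k}")
      case True
      moreover have "0 \<le> ?w k" using \<open>s \<le> t\<close> by (auto simp: clip_def)
      ultimately show ?thesis using bound k by (intro mult_left_mono) auto
    next
      case False
      then have "?w k = 0" using pos[of k] k \<open>s \<le> t\<close> by (auto simp: clip_def)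
      then show ?thesis by simp
    qed
  qed
  also have "\<dots> = b * (\<Sum>k<N. ?w k)" by (simp add: sum_distrib_left mult.commute)
  also have "(\<Sum>k<N. ?w k) = clip t (sum \<alpha> {..<N}) - clip s (sum \<alpha> {..<N})"
    using pos by (simp add: sum_subtractf sum_clip less_imp_le)
  finally show ?thesis .
qed

text \<open>Test the increment against itself in \<open>inner_polygon_diff_le\<close> and cancel one
  factor of its norm. All real times are allowed, since the polygon is constant outside its time
  range.\<close>

lemma norm_polygon_diff_le:
  fixes x :: "nat \<Rightarrow> 'a::real_inner"
  assumes pos: "\<And>k. k < N \<Longrightarrow> 0 < \<alpha> k" and "0 \<le> M"
    and bound: "\<And>k. k < N \<Longrightarrow> norm ((x (Suc k) - x k) /\<^sub>R \<alpha> k) \<le> M"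
  shows "norm (polygon N \<alpha> x t - polygon N \<alpha> x s) \<le> M * \<bar>t - s\<bar>"
proof -
  have le: "norm (polygon N \<alpha> x t - polygon N \<alpha> x s) \<le> M * (t - s)" if "s \<le> t" for s t
  proof -
    let ?p = "polygon N \<alpha> x t - polygon N \<alpha> x s"
    have clip: "clip t c - clip s c \<le> t - s" for c using that by (auto simp: clip_def)
    have "?p \<bullet> ?p \<le> (norm ?p * M) * (clip t (sum \<alpha> {..<N}) - clip s (sum \<alpha> {..<N}))"
    proof (rule inner_polygon_diff_le[OF pos that])
      fix k assume "k < N"
      then show "?p \<bullet> ((x (Suc k) - x k) /\<^sub>R \<alpha> k) \<le> norm ?p * M"
        using bound[of k] norm_cauchy_schwarz mult_left_mono[OF _ norm_ge_zero] by (metis order_trans)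
    qed
    also have "\<dots> \<le> norm ?p * M * (t - s)"
      using \<open>0 \<le> M\<close> clip by (intro mult_left_mono) auto
    finally have "norm ?p * norm ?p \<le> norm ?p * (M * (t - s))"
      by (simp add: power2_norm_eq_inner[symmetric] power2_eq_square mult.assoc)
    then show ?thesis
      by (metis \<open>0 \<le> M\<close> that diff_ge_0_iff_ge mult_left_le_imp_le mult_nonneg_nonneg norm_ge_zero
          order_le_less)
  qed
  show ?thesis using le[of s t] le[of t s] by (cases "s \<le> t") (auto simp: norm_minus_commute)
qed

text \<open>Take the last node time not exceeding \<open>t\<close>: the next node, if there is one,
  comes after \<open>t\<close> and at most \<open>h\<close> later.\<close>

lemma partial_sum_near:
  fixes \<alpha> :: "nat \<Rightarrow> real"
  assumes "\<And>k. k < N \<Longrightarrow> \<alpha> k \<le> h" and "0 \<le> t" "t \<le> sum \<alpha> {..<N}" and "0 \<le> h"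
  obtains k where "k \<le> N" "sum \<alpha> {..<k} \<le> t" "t \<le> sum \<alpha> {..<k} + h"
proof -
  define k where "k = (GREATEST k. k \<le> N \<and> sum \<alpha> {..<k} \<le> t)"
  have k: "k \<le> N \<and> sum \<alpha> {..<k} \<le> t"
    unfolding k_def by (rule GreatestI_nat[of _ 0 N]) (use assms in auto)
  have "t \<le> sum \<alpha> {..<k} + h"
  proof (cases "k = N")
    case True
    then show ?thesis using assms by simp
  next
    case False
    then have "\<not> sum \<alpha> {..<Suc k} \<le> t"
      using Greatest_le_nat[of "\<lambda>k. k \<le> N \<and> sum \<alpha> {..<k} \<le> t" "Suc k" N] k
      unfolding k_def[symmetric] by fastforce
    then show ?thesis using assms(1)[of k] False k by simp
  qed
  then show ?thesis using k that by blast
qed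

section \<open>Bounds on compact sets and Lipschitz regularity\<close>

text \<open>Upper semicontinuity bounds \<open>F\<close> near each point, and finitely many such
  neighbourhoods cover \<open>K\<close>.\<close>

lemma usc_bounded_on_compact:
  fixes F :: "'a::metric_space \<Rightarrow> 'b::real_normed_vector set"
  assumes usc: "upper_semicontinuous_map F" and vals: "\<And>x. compact (F x)" and "compact K"
  obtains M where "M > 0" "\<And>x v. x \<in> K \<Longrightarrow> v \<in> F x \<Longrightarrow> norm v \<le> M"
proof -
  have "\<exists>U R. open U \<and> x \<in> U \<and> (\<forall>y\<in>U. \<forall>v\<in>F y. norm v \<le> R)" for x
  proof -
    obtain R where R: "F x \<subseteq> ball 0 R"
      using vals[of x] bounded_subset_ballD compact_imp_bounded by blast
    then obtain U where "open U" "x \<in> U" "(\<Union>y\<in>U. F y) \<subseteq> ball 0 R"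
      using usc unfolding upper_semicontinuous_map_def by (meson open_ball)
    then show ?thesis by (intro exI[of _ U] exI[of _ R]) (auto simp: subset_iff less_imp_le)
  qed
  then obtain U R where UR: "\<And>x. open (U x)" "\<And>x. x \<in> U x"
      "\<And>x y v. y \<in> U x \<Longrightarrow> v \<in> F y \<Longrightarrow> norm v \<le> R x" by metis
  obtain C where C: "C \<subseteq> K" "finite C" "K \<subseteq> (\<Union>c\<in>C. U c)"
    using compactE_image[OF \<open>compact K\<close>, of K U] UR by blast
  \<comment> \<open>The summand 1 keeps \<open>M\<close> positive even for an empty cover.\<close>
  define M where "M = 1 + (\<Sum>c\<in>C. \<bar>R c\<bar>)"
  show thesis
  proof
    show "M > 0" unfolding M_def by (intro add_pos_nonneg sum_nonneg) auto
    fix x v assume "x \<in> K" "v \<in> F x"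
    then obtain c where c: "c \<in> C" "x \<in> U c" using C by blast
    then have "norm v \<le> R c" using UR \<open>v \<in> F x\<close> by blast
    moreover have "\<bar>R c\<bar> \<le> (\<Sum>c\<in>C. \<bar>R c\<bar>)" using c C by (intro member_le_sum) auto
    ultimately show "norm v \<le> M" by (simp add: M_def)
  qed
qed

lemma locally_lipschitz_imp_continuous_on:
  assumes "locally_lipschitz f"
  shows "continuous_on S f"
proof -
  have "isCont f x" for x
  proof -
    obtain e L where "e > 0" "L-lipschitz_on (ball x e) f"
      using assms unfolding locally_lipschitz_def by blast
    then show ?thesis
      using lipschitz_on_continuous_on continuous_on_eq_continuous_at[OF open_ball, of x e f] by auto
  qed
  then show ?thesis by (simp add: continuous_at_imp_continuous_on)
qed

text \<open>Makes the chain rule of a conservative field available for Lipschitz curves, such as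
  limits of polygons.\<close>

lemma lipschitz_imp_absolutely_continuous_curve_on:
  assumes lip: "L-lipschitz_on S x"
  shows "absolutely_continuous_curve_on S x"
  unfolding absolutely_continuous_curve_on_def
proof (intro allI impI)
  fix \<epsilon> :: real assume "\<epsilon> > 0"
  have "L \<ge> 0" using lip by (rule lipschitz_on_nonneg)
  show "\<exists>\<delta>>0. \<forall>P::(real \<times> real) set. finite P \<longrightarrow> (\<forall>(a, b)\<in>P. a < b \<and> {a..b} \<subseteq> S) \<longrightarrow>
        pairwise (\<lambda>(a, b) (c, d). disjnt {a<..<b} {c<..<d}) P \<longrightarrow>
        (\<Sum>(a, b)\<in>P. b - a) < \<delta> \<longrightarrow> (\<Sum>(a, b)\<in>P. norm (x b - x a)) < \<epsilon>"
  proof (intro exI[of _ "\<epsilon> / (L + 1)"] conjI allI impI)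
    show "0 < \<epsilon> / (L + 1)" using \<open>\<epsilon> > 0\<close> \<open>L \<ge> 0\<close> by simp
    fix P :: "(real \<times> real) set"
    assume P: "\<forall>(a, b)\<in>P. a < b \<and> {a..b} \<subseteq> S" and small: "(\<Sum>(a, b)\<in>P. b - a) < \<epsilon> / (L + 1)"
    have "(\<Sum>(a, b)\<in>P. norm (x b - x a)) \<le> (\<Sum>(a, b)\<in>P. L * (b - a))"
    proof (rule sum_mono, clarify)
      fix a b assume "(a, b) \<in> P"
      then have "a < b" "a \<in> S" "b \<in> S" using P by fastforce+
      then show "norm (x b - x a) \<le> L * (b - a)"
        using lipschitz_onD[OF lip, of b a] by (simp add: dist_norm)
    qed
    also have "\<dots> = L * (\<Sum>(a, b)\<in>P. b - a)"
      by (simp add: sum_distrib_left case_prod_unfold)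
    also have "\<dots> \<le> (L + 1) * (\<Sum>(a, b)\<in>P. b - a)"
      using P by (intro mult_right_mono sum_nonneg) auto
    also have "\<dots> < \<epsilon>" using small \<open>L \<ge> 0\<close> by (simp add: field_simps)
    finally show "(\<Sum>(a, b)\<in>P. norm (x b - x a)) < \<epsilon>" .
  qed
qed

section \<open>Descent rates and velocities of limit curves\<close>

text \<open>Since all \<open>v\<close> in \<open>B\<close> have the same product with
  \<open>u\<close>, the inner minimum at \<open>u\<close> is \<open>\<delta>\<close>, so
  \<open>\<delta>\<close> is at most minus the minimum of \<open>\<kappa>\<close> over
  \<open>B\<close>. That minimum is attained, hence positive when \<open>B\<close> misses 0.\<close>

lemma max_min_descent_imp_rate:
  fixes \<kappa> :: "'a::euclidean_space \<Rightarrow> real"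
  assumes "compact A" "compact B" "B \<noteq> {}" and \<kappa>: "\<kappa> \<in> pos_def_funs"
    and desc: "max_min_descent A B \<kappa>"
    and u: "u \<in> convex hull A" and const: "\<And>v. v \<in> B \<Longrightarrow> v \<bullet> u = \<delta>"
  shows "\<delta> \<le> 0" and "0 \<notin> B \<Longrightarrow> \<delta> < 0"
proof -
  \<comment> \<open>Over the reals the supremum is informative only for a bounded family; the single
    vector \<open>v0\<close> bounds all inner infima from above.\<close>
  obtain v0 where v0: "v0 \<in> B" using \<open>B \<noteq> {}\<close> by blast
  have bdd_B: "bdd_below ((\<lambda>v. w \<bullet> v) ` B)" for w
    using \<open>compact B\<close> by (intro bounded_imp_bdd_below compact_imp_bounded compact_continuous_image)
      (auto intro!: continuous_intros)
  have "compact (convex hull A)" using \<open>compact A\<close> by (rule compact_convex_hull)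
  then have "bdd_above ((\<lambda>w. w \<bullet> v0) ` (convex hull A))"
    by (intro bounded_imp_bdd_above compact_imp_bounded compact_continuous_image)
      (auto intro!: continuous_intros)
  then obtain R where R: "\<And>w. w \<in> convex hull A \<Longrightarrow> w \<bullet> v0 \<le> R"
    by (auto simp: bdd_above_def)
  have "bdd_above ((\<lambda>w. INF v\<in>B. w \<bullet> v) ` (convex hull A))"
    using R v0 by (intro bdd_aboveI2[of _ _ R] order_trans[OF cINF_lower[OF bdd_B v0]])
  then have "(INF v\<in>B. u \<bullet> v) \<le> (SUP w\<in>convex hull A. INF v\<in>B. w \<bullet> v)"
    using u by (rule cSUP_upper[rotated])
  moreover have "(INF v\<in>B. u \<bullet> v) = \<delta>"
    using const \<open>B \<noteq> {}\<close> by (simp add: inner_commute)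
  ultimately have le: "\<delta> \<le> - (INF w\<in>B. \<kappa> w)"
    using desc by (simp add: max_min_descent_def)
  have "continuous_on B \<kappa>"
    using \<kappa> continuous_on_subset by (fastforce simp: pos_def_funs_def)
  then obtain w where w: "w \<in> B" "\<And>z. z \<in> B \<Longrightarrow> \<kappa> w \<le> \<kappa> z"
    using continuous_attains_inf[OF \<open>compact B\<close> \<open>B \<noteq> {}\<close>] by blast
  then have "\<kappa> w \<le> (INF w\<in>B. \<kappa> w)"
    using \<open>B \<noteq> {}\<close> by (intro cINF_greatest) auto
  with le have "\<delta> \<le> - \<kappa> w" by simp
  moreover have "\<kappa> w \<ge> 0" "w \<noteq> 0 \<Longrightarrow> \<kappa> w > 0"
    using \<kappa> by (cases "w = 0"; auto simp: pos_def_funs_def intro: less_imp_le)+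
  ultimately show "\<delta> \<le> 0" "0 \<notin> B \<Longrightarrow> \<delta> < 0" using w by force+
qed

text \<open>If the limit velocity were not in the convex hull, a half-space would separate it from
  \<open>F (y t)\<close>; by upper semicontinuity all nearby edge velocities lie in that half-space, and
  hence so do the difference quotients of the polygons and their limit.\<close>

lemma limit_of_polygons_velocity:
  fixes F :: "'a::euclidean_space \<Rightarrow> 'a set"
  assumes usc: "upper_semicontinuous_map F" and vals: "\<And>x. compact (F x)"
    and path: "\<And>n. euler_path F K (h n) (N n) (\<alpha> n) (x n)"
    and M: "M > 0" "\<And>x v. x \<in> K \<Longrightarrow> v \<in> F x \<Longrightarrow> norm v \<le> M"
    and h: "h \<longlonglongrightarrow> 0" and long: "\<And>n. \<tau> \<le> sum (\<alpha> n) {..<N n}"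
    and lim: "\<And>t. t \<in> {0..\<tau>} \<Longrightarrow> (\<lambda>n. polygon (N n) (\<alpha> n) (x n) t) \<longlonglongrightarrow> y t"
    and t: "t \<in> {0<..<\<tau>}" and y': "(y has_vector_derivative y') (at t)"
  shows "y' \<in> convex hull F (y t)"
proof (rule ccontr)
  let ?P = "\<lambda>n. polygon (N n) (\<alpha> n) (x n)"
  assume "y' \<notin> convex hull F (y t)"
  moreover have "compact (convex hull F (y t))" using vals by (rule compact_convex_hull)
  ultimately obtain a b where ab: "a \<bullet> y' < b" "\<And>u. u \<in> convex hull F (y t) \<Longrightarrow> b < a \<bullet> u"
    using separating_hyperplane_closed_point[OF convex_convex_hull compact_imp_closed] by blast
  have pos: "0 < \<alpha> n k" "\<alpha> n k \<le> h n" "(x n (Suc k) - x n k) /\<^sub>R \<alpha> n k \<in> F (x n k)" "x n k \<in> K"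
    if "k < N n" for n k
    using path[of n] that by (auto simp: euler_path_def)
  have P_lip: "norm (?P n s - ?P n r) \<le> M * \<bar>s - r\<bar>" for n r s
  proof (rule norm_polygon_diff_le)
    show "norm ((x n (Suc k) - x n k) /\<^sub>R \<alpha> n k) \<le> M" if "k < N n" for k
      using M(2) pos(3,4) that by blast
  qed (use M pos in auto)
  have "F (y t) \<subseteq> {u. b < a \<bullet> u}" using ab(2) by (auto intro: hull_inc)
  moreover have "open {u. b < a \<bullet> u}" by (rule open_halfspace_gt)
  ultimately obtain U where "open U" "y t \<in> U" and U: "(\<Union>z\<in>U. F z) \<subseteq> {u. b < a \<bullet> u}"
    using usc unfolding upper_semicontinuous_map_def by meson
  then obtain r where r: "r > 0" "ball (y t) r \<subseteq> U" by (meson open_contains_ball)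
  \<comment> \<open>The first bound keeps \<open>t + s\<close> within the common time range. The
    second makes every node whose edge matters lie within \<open>r / 4\<close> of the polygon at
    time \<open>t\<close>, once the steps are below \<open>r / (4 * M)\<close>.\<close>
  define d where "d = min (\<tau> - t) (r / (4 * M))"
  have "d > 0" using t r M by (simp add: d_def)
  have incr: "b * s \<le> a \<bullet> (y (t + s) - y t)" if s: "0 < s" "s < d" for s
  proof -
    have "\<forall>\<^sub>F n in sequentially. b * s \<le> a \<bullet> (?P n (t + s) - ?P n t)"
    proof -
      have "\<forall>\<^sub>F n in sequentially. h n < r / (4 * M)"
        using h r M by (intro order_tendstoD(2)[OF h]) simp
      moreover have "\<forall>\<^sub>F n in sequentially. dist (?P n t) (y t) < r / 2"
        using lim[of t] t r by (intro tendstoD) auto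
      ultimately show ?thesis
      proof eventually_elim
        case (elim n)
        let ?T = "sum (\<alpha> n) {..<N n}"
        \<comment> \<open>A lower bound is wanted, hence the signs.\<close>
        have "(- a) \<bullet> (?P n (t + s) - ?P n t) \<le> (- b) * (clip (t + s) ?T - clip t ?T)"
        proof (rule inner_polygon_diff_le)
          fix k assume k: "k < N n" "sum (\<alpha> n) {..<k} < t + s" "t < sum (\<alpha> n) {..<Suc k}"
          let ?S = "sum (\<alpha> n) {..<k}"
          have "?P n ?S = x n k" using pos k by (intro polygon_node) auto
          moreover have "\<bar>?S - t\<bar> < r / (4 * M)"
            using k pos(2)[of k n] elim s by (auto simp: d_def)
          then have "M * \<bar>?S - t\<bar> < r / 4"
            using M by (simp add: field_simps)
          ultimately have "dist (x n k) (?P n t) < r / 4"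
            using P_lip[of n ?S t] by (simp add: dist_norm)
          then have "dist (y t) (x n k) < r"
            using elim dist_triangle[of "y t" "x n k" "?P n t"] r by (simp add: dist_commute)
          then have "x n k \<in> U" using r by auto
          then show "(- a) \<bullet> ((x n (Suc k) - x n k) /\<^sub>R \<alpha> n k) \<le> - b"
            using U pos(3)[OF k(1)] by (force simp: subset_iff)
        qed (use pos s in auto)
        moreover have "clip (t + s) ?T - clip t ?T = s"
          using long[of n] s t by (simp add: d_def clip_def)
        ultimately show ?case by simp
      qed
    qed
    moreover have "(\<lambda>n. a \<bullet> (?P n (t + s) - ?P n t)) \<longlonglongrightarrow> a \<bullet> (y (t + s) - y t)"
      using s t by (intro tendsto_intros lim) (auto simp: d_def)
    ultimately show ?thesis by (intro tendsto_lowerbound[where F = sequentially]) auto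
  qed
  have "((\<lambda>s. a \<bullet> y s) has_real_derivative a \<bullet> y') (at t)"
    using y' unfolding has_vector_derivative_def has_field_derivative_def
    by (auto intro!: derivative_eq_intros simp: mult.commute)
  \<comment> \<open>This function must decrease strictly just after \<open>t\<close>, whereas
    \<open>incr\<close> says that it does not.\<close>
  then have "((\<lambda>s. a \<bullet> y s - b * s) has_real_derivative a \<bullet> y' - b) (at t)"
    by (auto intro!: derivative_eq_intros)
  moreover have "a \<bullet> y' - b < 0" using ab by simp
  ultimately obtain e where e: "e > 0"
      "\<And>s. 0 < s \<Longrightarrow> s < e \<Longrightarrow> a \<bullet> y (t + s) - b * (t + s) < a \<bullet> y t - b * t"
    using DERIV_neg_dec_right by blast
  define s where "s = min d e / 2"
  have "0 < s" "s < d" "s < e" using \<open>d > 0\<close> \<open>e > 0\<close> by (auto simp: s_def)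
  then show False using incr[of s] e(2)[of s] by (simp add: algebra_simps)
qed

section \<open>A barrier at noncritical levels\<close>

text \<open>Cutting at the last index with level at most \<open>c\<close> puts all later nodes above
  \<open>c\<close>, a bound that survives passage to the limit.\<close>

lemma euler_path_after_last_below:
  assumes path: "euler_path F K h N \<alpha> x" and "\<phi> (x 0) \<le> (c::real)"
  obtains p where "p \<le> N" "euler_path F K h (N - p) (\<lambda>k. \<alpha> (k + p)) (\<lambda>k. x (k + p))"
    "\<phi> (x p) \<le> c" "\<And>k. 0 < k \<Longrightarrow> k \<le> N - p \<Longrightarrow> c < \<phi> (x (k + p))"
proof -
  define p where "p = (GREATEST p. p \<le> N \<and> \<phi> (x p) \<le> c)"
  have p: "p \<le> N \<and> \<phi> (x p) \<le> c"
    unfolding p_def by (rule GreatestI_nat[of _ 0 N]) (use assms in auto)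
  have "c < \<phi> (x (k + p))" if "0 < k" "k \<le> N - p" for k
    using Greatest_le_nat[of "\<lambda>p. p \<le> N \<and> \<phi> (x p) \<le> c" "k + p" N] that p
    unfolding p_def[symmetric] by fastforce
  moreover have "euler_path F K h (N - p) (\<lambda>k. \<alpha> (k + p)) (\<lambda>k. x (k + p))"
    using path p by (auto simp: euler_path_def)
  ultimately show thesis using p that by blast
qed

text \<open>Otherwise there are Euler paths with step sizes tending to \<open>0\<close> which start at or below level
  \<open>c\<close>, end at or above level \<open>c'\<close> and stay above \<open>c\<close> in between.  Since they need a minimal time to
  do so, they accumulate at a curve \<open>y\<close> with velocities in the convex hull of \<open>F\<close>, along which \<open>f\<close>
  is nonincreasing, but which starts at level \<open>c\<close> and never falls below it.  So \<open>f = c\<close> along \<open>y\<close>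
  for a short time, and \<open>f\<close> has zero derivative at a noncritical point, against the descent
  condition.\<close>

lemma euler_path_below_noncritical_level:
  fixes F D :: "'a::euclidean_space \<Rightarrow> 'a set"
  assumes usc: "upper_semicontinuous_map F" and vals: "\<And>x. F x \<noteq> {} \<and> compact (F x)"
    and pot: "conservative_field D f"
    and descent: "\<And>z. \<exists>\<rho>>0. \<exists>\<kappa>\<in>pos_def_funs. \<forall>x\<in>ball z \<rho>. max_min_descent (F x) (D x) \<kappa>"
    and "compact K" and c: "c \<notin> critical_values D f" and "c < c'"
  shows "\<exists>h>0. \<forall>N \<alpha> x. euler_path F K h N \<alpha> x \<longrightarrow> f (x 0) \<le> c \<longrightarrow> f (x N) < c'"
proof (rule ccontr)
  assume "\<not> ?thesis"
  then have climb: "\<exists>N \<alpha> x. euler_path F K h N \<alpha> x \<and> f (x 0) \<le> c \<and> c' \<le> f (x N)" if "h > 0" for h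
    using that by (meson not_le)
  have "\<exists>N \<alpha> x. euler_path F K h N \<alpha> x \<and> f (x 0) \<le> c \<and> c' \<le> f (x N) \<and>
      (\<forall>k. 0 < k \<longrightarrow> k \<le> N \<longrightarrow> c < f (x k))" if h: "h > 0" for h
  proof -
    obtain N \<alpha> x where 1: "euler_path F K h N \<alpha> x" "f (x 0) \<le> c" "c' \<le> f (x N)"
      using climb[OF h] by blast
    obtain p where "p \<le> N" "euler_path F K h (N - p) (\<lambda>k. \<alpha> (k + p)) (\<lambda>k. x (k + p))"
      "f (x p) \<le> c" "\<And>k. 0 < k \<Longrightarrow> k \<le> N - p \<Longrightarrow> c < f (x (k + p))"
      using euler_path_after_last_below[of F K h N \<alpha> x f c] 1(1,2) by metis
    with 1(3) show ?thesis
      by (intro exI[of _ "N - p"] exI[of _ "\<lambda>k. \<alpha> (k + p)"] exI[of _ "\<lambda>k. x (k + p)"]) auto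
  qed
  then have "\<exists>N \<alpha> x. euler_path F K (inverse (real (Suc n))) N \<alpha> x \<and> f (x 0) \<le> c \<and>
      c' \<le> f (x N) \<and> (\<forall>k. 0 < k \<longrightarrow> k \<le> N \<longrightarrow> c < f (x k))" for n
    by simp
  then obtain N \<alpha> x where path: "\<And>n::nat. euler_path F K (inverse (real (Suc n))) (N n) (\<alpha> n) (x n)"
    and start: "\<And>n. f (x n 0) \<le> c" and final: "\<And>n. c' \<le> f (x n (N n))"
    and above: "\<And>n k. 0 < k \<Longrightarrow> k \<le> N n \<Longrightarrow> c < f (x n k)"
    by metis
  have pos: "0 < \<alpha> n k" "\<alpha> n k \<le> inverse (real (Suc n))"
      "(x n (Suc k) - x n k) /\<^sub>R \<alpha> n k \<in> F (x n k)" if "k < N n" for n k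
    using path[of n] that by (auto simp: euler_path_def)
  have inK: "x n k \<in> K" if "k \<le> N n" for n k
    using path[of n] that by (auto simp: euler_path_def)
  obtain M where M: "M > 0" "\<And>x v. x \<in> K \<Longrightarrow> v \<in> F x \<Longrightarrow> norm v \<le> M"
    using usc_bounded_on_compact[OF usc _ \<open>compact K\<close>] vals by metis
  let ?P = "\<lambda>n. polygon (N n) (\<alpha> n) (x n)"
  let ?T = "\<lambda>n. sum (\<alpha> n) {..<N n}"
  have P_lip: "norm (?P n s - ?P n r) \<le> M * \<bar>s - r\<bar>" for n r s
  proof (rule norm_polygon_diff_le)
    show "norm ((x n (Suc k) - x n k) /\<^sub>R \<alpha> n k) \<le> M" if "k < N n" for k
      using M(2) pos(3) inK that by (meson less_imp_le)
  qed (use M pos in auto)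
  have P_node: "?P n (sum (\<alpha> n) {..<m}) = x n m" if "m \<le> N n" for n m
    using pos that by (intro polygon_node) auto
  have T_nonneg: "0 \<le> ?T n" for n using pos by (intro sum_nonneg) (auto intro: less_imp_le)
  have lip: "locally_lipschitz f" using pot by (simp add: conservative_field_def)
  have f_cont: "continuous_on S f" for S
    using lip by (rule locally_lipschitz_imp_continuous_on)
  \<comment> \<open>Climbing from level \<open>c\<close> to \<open>c'\<close> requires a
    displacement of at least \<open>d\<close>, hence at speed \<open>M\<close> a time of at least
    \<open>d / M\<close>.\<close>
  obtain d where "d > 0"
    and d: "\<And>x z. x \<in> K \<Longrightarrow> z \<in> K \<Longrightarrow> dist z x < d \<Longrightarrow> dist (f z) (f x) < c' - c"
    using compact_uniformly_continuous[OF f_cont \<open>compact K\<close>] \<open>c < c'\<close>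
    unfolding uniformly_continuous_on_def by (metis diff_gt_0_iff_gt)
  define \<tau> where "\<tau> = min 1 (d / M)"
  have \<tau>: "0 < \<tau>" "\<tau> \<le> 1" using \<open>d > 0\<close> M by (auto simp: \<tau>_def)
  have long: "\<tau> \<le> ?T n" for n
  proof -
    have "\<not> dist (x n (N n)) (x n 0) < d"
      using d[of "x n 0" "x n (N n)"] inK[of _ n] start[of n] final[of n] by (auto simp: dist_real_def)
    moreover have "dist (x n (N n)) (x n 0) \<le> M * ?T n"
      using P_lip[of n "?T n" 0] P_node[of "N n" n] P_node[of 0 n] T_nonneg[of n]
      by (simp add: dist_norm)
    ultimately have "d / M \<le> ?T n" using M by (simp add: field_simps)
    then show ?thesis by (simp add: \<tau>_def)
  qed
  obtain R where R: "\<And>z. z \<in> K \<Longrightarrow> norm z \<le> R"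
    using compact_imp_bounded[OF \<open>compact K\<close>] bounded_iff by metis
  \<comment> \<open>Polygons whose time runs out before 1 stay constant afterwards, so all live on
    the interval required by the chain rule. Velocities are identified only before
    \<open>\<tau>\<close>.\<close>
  obtain y \<sigma> where "continuous_on {0..1} y" and \<sigma>: "strict_mono (\<sigma> :: nat \<Rightarrow> nat)"
    and unif: "\<And>e. 0 < e \<Longrightarrow> \<exists>n0. \<forall>n t. n \<ge> n0 \<and> t \<in> {0..1::real} \<longrightarrow> norm (?P (\<sigma> n) t - y t) < e"
  proof (rule Arzela_Ascoli[of "{0..1::real}" ?P "R + M"])
    fix n and t :: real assume t: "t \<in> {0..1}"
    have "?P n 0 = x n 0" using P_node[of 0 n] by simp
    then have "norm (?P n t) \<le> norm (x n 0) + M * \<bar>t\<bar>"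
      using P_lip[of n t 0] norm_triangle_sub[of "?P n t" "?P n 0"] by simp
    also have "\<dots> \<le> R + M * 1"
      using R[OF inK[of 0 n]] t M by (intro add_mono mult_left_mono) auto
    finally show "norm (?P n t) \<le> R + M" by simp
  next
    fix t e :: real assume "0 < e"
    have "norm (?P n t - ?P n s) < e" if "norm (t - s) < e / M" for n s
      using le_less_trans[OF P_lip[of n t s]] that M by (simp add: field_simps)
    then show "\<exists>d>0. \<forall>n s. s \<in> {0..1} \<and> norm (t - s) < d \<longrightarrow> norm (?P n t - ?P n s) < e"
      using \<open>0 < e\<close> M by (intro exI[of _ "e / M"]) auto
  qed (auto simp: that)
  have lim: "(\<lambda>n. ?P (\<sigma> n) t) \<longlonglongrightarrow> y t" if "t \<in> {0..1}" for t
    unfolding LIMSEQ_iff using unif that by meson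
  have small: "(\<lambda>n. inverse (real (Suc (\<sigma> n)))) \<longlonglongrightarrow> 0"
    using LIMSEQ_subseq_LIMSEQ[OF LIMSEQ_inverse_real_of_nat \<sigma>] by (simp add: o_def)
  have y_lip: "M-lipschitz_on {0..1} y"
  proof (rule lipschitz_onI)
    fix s t :: real assume "s \<in> {0..1}" "t \<in> {0..1}"
    then have "(\<lambda>n. norm (?P (\<sigma> n) s - ?P (\<sigma> n) t)) \<longlonglongrightarrow> norm (y s - y t)"
      by (intro tendsto_intros lim)
    then have "norm (y s - y t) \<le> M * \<bar>s - t\<bar>"
      using P_lip by (intro LIMSEQ_le_const2) auto
    then show "dist (y s) (y t) \<le> M * dist s t" by (simp add: dist_norm)
  qed (use M in simp)
  have f_lim: "(\<lambda>n. f (z n)) \<longlonglongrightarrow> f l" if "z \<longlonglongrightarrow> l" for z l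
    using f_cont[of UNIV] that continuous_on_tendsto_compose[of UNIV f z l sequentially] by simp
  have y0: "f (y 0) \<le> c"
  proof (rule LIMSEQ_le_const2[OF f_lim[OF lim[of 0]]])
    show "\<exists>N'. \<forall>n\<ge>N'. f (?P (\<sigma> n) 0) \<le> c" using start P_node[of 0] by simp
  qed simp
  have y_above: "c \<le> f (y t)" if t: "0 < t" "t \<le> \<tau>" for t
  proof -
    have "\<exists>k\<le>N n. sum (\<alpha> n) {..<k} \<le> t \<and> t \<le> sum (\<alpha> n) {..<k} + inverse (real (Suc n))" for n
    proof -
      have "0 \<le> t" "t \<le> ?T n" using long[of n] t by simp_all
      then obtain k where "k \<le> N n" "sum (\<alpha> n) {..<k} \<le> t"
          "t \<le> sum (\<alpha> n) {..<k} + inverse (real (Suc n))"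
        by (rule partial_sum_near[OF pos(2), rotated]) auto
      then show ?thesis by blast
    qed
    then obtain k where k: "\<And>n. k n \<le> N n" "\<And>n. sum (\<alpha> n) {..<k n} \<le> t"
        "\<And>n. t \<le> sum (\<alpha> n) {..<k n} + inverse (real (Suc n))"
      by metis
    have "(\<lambda>n. x (\<sigma> n) (k (\<sigma> n)) - ?P (\<sigma> n) t) \<longlonglongrightarrow> 0"
    proof (rule tendsto_norm_zero_cancel, rule tendsto_sandwich[OF _ _ tendsto_const])
      show "(\<lambda>n. M * inverse (real (Suc (\<sigma> n)))) \<longlonglongrightarrow> 0"
        using tendsto_mult[OF tendsto_const small, of M] by simp
      have "norm (x n (k n) - ?P n t) \<le> M * inverse (real (Suc n))" for n
      proof -
        have "norm (x n (k n) - ?P n t) \<le> M * \<bar>sum (\<alpha> n) {..<k n} - t\<bar>"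
          using P_lip[of n _ t] P_node[OF k(1)] by metis
        also have "\<dots> \<le> M * inverse (real (Suc n))"
          using k(2,3)[of n] M by (intro mult_left_mono) auto
        finally show ?thesis .
      qed
      then show "\<forall>\<^sub>F n in sequentially. norm (x (\<sigma> n) (k (\<sigma> n)) - ?P (\<sigma> n) t)
          \<le> M * inverse (real (Suc (\<sigma> n)))" by simp
    qed simp
    from tendsto_add[OF this lim[of t]] have "(\<lambda>n. x (\<sigma> n) (k (\<sigma> n))) \<longlonglongrightarrow> y t"
      using t \<tau> by simp
    then have "(\<lambda>n. f (x (\<sigma> n) (k (\<sigma> n)))) \<longlonglongrightarrow> f (y t)" by (rule f_lim)
    moreover have "\<forall>\<^sub>F n in sequentially. c \<le> f (x (\<sigma> n) (k (\<sigma> n)))"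
      using order_tendstoD(2)[OF small, of t, OF t(1)]
    proof eventually_elim
      case (elim n)
      \<comment> \<open>The starting node is the only one that may lie below \<open>c\<close>. It is
        excluded because \<open>t > 0\<close> eventually exceeds the step bound.\<close>
      have "k (\<sigma> n) \<noteq> 0"
      proof
        assume "k (\<sigma> n) = 0"
        then show False using k(3)[of "\<sigma> n"] elim by simp
      qed
      then show ?case using above[OF _ k(1), of "\<sigma> n"] by simp
    qed
    ultimately show ?thesis by (intro tendsto_lowerbound[where F = sequentially]) auto
  qed
  obtain e L where "e > 0" and L: "L-lipschitz_on (ball (y 0) e) f"
    using lip unfolding locally_lipschitz_def by blast
  \<comment> \<open>Up to time \<open>s\<close> the curve stays in a ball on which \<open>f\<close>
    is Lipschitz, so \<open>f \<circ> y\<close> is Lipschitz there.\<close>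
  define s where "s = min \<tau> (e / (2 * M))"
  have s: "0 < s" "s \<le> \<tau>" "M * s < e"
  proof -
    show "0 < s" "s \<le> \<tau>" using \<tau> \<open>e > 0\<close> M by (auto simp: s_def)
    have "M * s \<le> M * (e / (2 * M))" using M by (intro mult_left_mono) (auto simp: s_def)
    also have "\<dots> < e" using \<open>e > 0\<close> M by simp
    finally show "M * s < e" .
  qed
  have "y ` {0..s} \<subseteq> ball (y 0) e"
  proof clarify
    fix t assume t: "t \<in> {0..s}"
    then have "dist (y 0) (y t) \<le> M * t"
      using lipschitz_onD[OF y_lip, of 0 t] s \<tau> by simp
    also have "\<dots> \<le> M * s" using t M by (intro mult_left_mono) auto
    finally show "y t \<in> ball (y 0) e" using s by simp
  qed
  moreover have "M-lipschitz_on {0..s} y"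
    using s \<tau> by (intro lipschitz_on_subset[OF y_lip]) auto
  ultimately have fy_lip: "(L * M)-lipschitz_on {0..s} (f \<circ> y)"
    by (intro lipschitz_on_compose lipschitz_on_subset[OF L])
  let ?chain = "\<lambda>t. \<exists>y'. (y has_vector_derivative y') (at t) \<and>
      (\<forall>v\<in>D (y t). ((f \<circ> y) has_real_derivative (v \<bullet> y')) (at t))"
  have "AE t in lebesgue. t \<in> {0<..<1} \<longrightarrow> ?chain t"
    using pot lipschitz_imp_absolutely_continuous_curve_on[OF y_lip]
    unfolding conservative_field_def by blast
  then obtain Z where "Z \<in> null_sets lebesgue"
      and Z_sub: "{t \<in> space lebesgue. \<not> (t \<in> {0<..<1} \<longrightarrow> ?chain t)} \<subseteq> Z"
    unfolding eventually_ae_filter by (elim bexE)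
  then have "negligible Z" by (simp add: negligible_iff_null_sets)
  have Z: "?chain t" if "t \<in> {0<..<1} - Z" for t
    using Z_sub that by auto
  \<comment> \<open>The chain rule gives the same derivative for every element of
    \<open>D (y t)\<close>, so \<open>max_min_descent_imp_rate\<close> applies. At level
    \<open>c\<close> the point is noncritical, which makes the sign strict.\<close>
  have rate: "\<exists>\<delta>. ((f \<circ> y) has_real_derivative \<delta>) (at t) \<and> \<delta> \<le> 0 \<and> (f (y t) = c \<longrightarrow> \<delta> < 0)"
    if t: "t \<in> {0<..<s} - Z" for t
  proof -
    obtain y' where y': "(y has_vector_derivative y') (at t)"
      and chain: "\<And>v. v \<in> D (y t) \<Longrightarrow> ((f \<circ> y) has_real_derivative (v \<bullet> y')) (at t)"
      using Z[of t] t s \<tau> by auto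
    have D: "D (y t) \<noteq> {}" "compact (D (y t))" using pot by (auto simp: conservative_field_def)
    then obtain v where v: "v \<in> D (y t)" by blast
    have y'_in: "y' \<in> convex hull F (y t)"
    proof (rule limit_of_polygons_velocity[OF usc _ path M small long _ _ y'])
      show "(\<lambda>n. ?P (\<sigma> n) t) \<longlonglongrightarrow> y t" if "t \<in> {0..\<tau>}" for t
        using lim[of t] that \<tau> by simp
    qed (use vals t s in auto)
    obtain \<kappa> where "\<kappa> \<in> pos_def_funs" "max_min_descent (F (y t)) (D (y t)) \<kappa>"
      using descent[of "y t"] by (meson centre_in_ball)
    moreover have "w \<bullet> y' = v \<bullet> y'" if "w \<in> D (y t)" for w
      using chain[OF that] chain[OF v] by (rule DERIV_unique)
    ultimately have "v \<bullet> y' \<le> 0" "0 \<notin> D (y t) \<Longrightarrow> v \<bullet> y' < 0"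
      using max_min_descent_imp_rate[of "F (y t)" "D (y t)" \<kappa> y' "v \<bullet> y'"] vals D y'_in by blast+
    moreover have "0 \<notin> D (y t)" if "f (y t) = c"
      using c that by (auto simp: critical_values_def)
    ultimately show ?thesis using chain[OF v] by blast
  qed
  have const: "f (y t) = c" if t: "t \<in> {0<..<s}" for t
  proof (rule antisym)
    have "(f \<circ> y) t \<le> (f \<circ> y) 0"
    proof (rule lipschitz_deriv_nonpos_imp_le[where \<phi> = "f \<circ> y", OF _ _ \<open>negligible Z\<close>])
      show "(L * M)-lipschitz_on {0..t} (f \<circ> y)"
        using t by (intro lipschitz_on_subset[OF fy_lip]) auto
    qed (use rate t in force)+
    then show "f (y t) \<le> c" using y0 by simp
  qed (use y_above t s in auto)
  have "\<not> negligible {0<..<s}" using s open_not_negligible[of "{0<..<s}"] by auto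
  then obtain t where t: "t \<in> {0<..<s} - Z"
    using \<open>negligible Z\<close> negligible_subset by blast
  then obtain \<delta> where \<delta>: "((f \<circ> y) has_real_derivative \<delta>) (at t)" "\<delta> < 0"
    using rate[OF t] const by blast
  have "((f \<circ> y) has_real_derivative 0) (at t)"
    by (rule has_field_derivative_transform_within_open[of "\<lambda>_. c" _ _ "{0<..<s}"]) (use t const in auto)
  then show False using \<delta> DERIV_unique by blast
qed

section \<open>Stability of the strict minimizer\<close>

lemma discrete_trajectory_euler_path:
  assumes "discrete_trajectory F \<alpha> x" "\<And>k. 0 < \<alpha> k" "\<And>k. \<alpha> k \<le> h" "\<And>k. k \<le> N \<Longrightarrow> x k \<in> K"
  shows "euler_path F K h N \<alpha> x"
proof -
  have "(x (Suc k) - x k) /\<^sub>R \<alpha> k \<in> F (x k)" for k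
  proof -
    obtain u where "u \<in> F (x k)" "x (Suc k) = x k + \<alpha> k *\<^sub>R u"
      using assms(1) unfolding discrete_trajectory_def by blast
    then show ?thesis using assms(2)[of k] by simp
  qed
  with assms show ?thesis by (simp add: euler_path_def)
qed

text \<open>Addition on \<open>ereal\<close> fails to be continuous only where opposite infinities
  meet, which the real summand excludes.\<close>

lemma continuous_on_ereal_add:
  fixes g :: "'a::topological_space \<Rightarrow> ereal"
  assumes "continuous_on S f" "continuous_on S g"
  shows "continuous_on S (\<lambda>x. ereal (f x) + g x)"
  using assms unfolding continuous_on_def
  by (intro ballI tendsto_add_ereal_general) (auto intro: tendsto_intros)

theorem theorem1p2:
  fixes xbar :: "real ^ 'n"
    and F D :: "real ^ 'n \<Rightarrow> (real ^ 'n) set"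
    and f :: "real ^ 'n \<Rightarrow> real"
    and g :: "real ^ 'n \<Rightarrow> ereal"
  assumes F_usc: "upper_semicontinuous_map F"
    and F_values: "\<And>x. F x \<noteq> {} \<and> compact (F x)"
    and f_potential: "conservative_field D f"
    and descent: "\<And>xhat. \<exists>\<rho>>0. \<exists>\<kappa>\<in>pos_def_funs. \<forall>x\<in>ball xhat \<rho>. max_min_descent (F x) (D x) \<kappa>"
    and isolated: "f xbar isolated_in critical_values D f"
    and g_range: "\<And>x. g x \<noteq> -\<infinity>"
    and g_near: "\<exists>U. open U \<and> xbar \<in> U \<and> continuous_on U g \<and> d_lyapunov_on U F g"
    and strict_min: "strict_local_minimum (\<lambda>x. ereal (f x) + g x) xbar"
  shows "d_stable F xbar"
  unfolding d_stable_def
proof (intro allI impI)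
  fix \<epsilon> :: real assume "\<epsilon> > 0"
  let ?h = "\<lambda>x. ereal (f x) + g x"
  obtain U where U: "open U" "xbar \<in> U" "continuous_on U g" "d_lyapunov_on U F g"
    using g_near by blast
  obtain W where W: "open W" "xbar \<in> W" "\<And>x. x \<in> W - {xbar} \<Longrightarrow> ?h xbar < ?h x"
    using strict_min unfolding strict_local_minimum_def by blast
  have f_cont: "continuous_on S f" for S
    using f_potential locally_lipschitz_imp_continuous_on by (auto simp: conservative_field_def)
  \<comment> \<open>The space has no isolated points, so \<open>W\<close> contains a point with a
    strictly larger value; this forces \<open>g xbar\<close> to be finite.\<close>
  have "W \<noteq> {xbar}" using W(1) not_open_singleton by metis
  then obtain w where "w \<in> W - {xbar}" using W(2) by blast
  then have "g xbar \<noteq> \<infinity>" using W(3)[of w] by auto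
  then obtain gb where gb: "g xbar = ereal gb" using g_range[of xbar] by (cases "g xbar") auto
  have "open (U \<inter> W \<inter> ball xbar \<epsilon>)" "xbar \<in> U \<inter> W \<inter> ball xbar \<epsilon>"
    using U W \<open>\<epsilon> > 0\<close> by auto
  then obtain r where "r > 0" and r: "cball xbar r \<subseteq> U \<inter> W \<inter> ball xbar \<epsilon>"
    by (meson open_contains_cball)
  let ?A = "cball xbar r - ball xbar (r / 2)"
  have "compact ?A" by (simp add: compact_diff)
  have "\<exists>m>0. \<forall>x\<in>?A. ereal (f xbar + gb + m) < ?h x"
  proof (cases "?A = {}")
    case True
    then show ?thesis by (auto intro: exI[of _ 1])
  next
    case False
    have "continuous_on ?A ?h"
      using r by (intro continuous_on_ereal_add f_cont continuous_on_subset[OF U(3)]) auto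
    then obtain z where z: "z \<in> ?A" "\<And>x. x \<in> ?A \<Longrightarrow> ?h z \<le> ?h x"
      using continuous_attains_inf[OF \<open>compact ?A\<close> False] by blast
    have "ereal (f xbar + gb) < ?h z"
    proof -
      have "z \<in> W - {xbar}" using z(1) r \<open>r > 0\<close> by auto
      then show ?thesis using W(3)[of z] gb by simp
    qed
    \<comment> \<open>The minimum over the annulus may be infinite, so a real number strictly below
      it defines the margin.\<close>
    then obtain b where b: "ereal (f xbar + gb) < ereal b" "ereal b < ?h z"
      using ereal_dense2 by blast
    then show ?thesis
      using z(2) by (intro exI[of _ "b - (f xbar + gb)"]) (auto intro: less_le_trans)
  qed
  then obtain m where "m > 0" and m: "\<And>x. x \<in> ?A \<Longrightarrow> ereal (f xbar + gb + m) < ?h x"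
    by blast
  obtain d where "d > 0" and d: "\<And>v. v \<in> critical_values D f \<Longrightarrow> dist (f xbar) v < d \<Longrightarrow> v = f xbar"
    using isolated_inE_dist[OF isolated] by metis
  \<comment> \<open>\<open>d / 2\<close> keeps \<open>c\<close> within the gap above the isolated
    critical value, and \<open>m / 4\<close> keeps it below \<open>c'\<close>. The level
    \<open>c'\<close> uses half of the margin \<open>m\<close>; the other half is left for
    \<open>g\<close>.\<close>
  define c where "c = f xbar + min (d / 2) (m / 4)"
  define c' where "c' = f xbar + m / 2"
  have c: "f xbar < c" "c < c'" using \<open>m > 0\<close> \<open>d > 0\<close> by (auto simp: c_def c'_def)
  have "c \<notin> critical_values D f"
  proof
    assume "c \<in> critical_values D f"
    moreover have "dist (f xbar) c < d" using \<open>m > 0\<close> \<open>d > 0\<close> by (simp add: c_def dist_real_def)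
    ultimately show False using d c by force
  qed
  from euler_path_below_noncritical_level[OF F_usc F_values f_potential descent compact_cball this c(2)]
  obtain h where "h > 0" and below: "\<And>N \<alpha> x. euler_path F (cball xbar r) h N \<alpha> x \<Longrightarrow>
      f (x 0) \<le> c \<Longrightarrow> f (x N) < c'" by metis
  obtain a0 where "a0 > 0" and lyap: "\<And>\<alpha> x k. range \<alpha> \<subseteq> {0<..a0} \<Longrightarrow> discrete_trajectory F \<alpha> x \<Longrightarrow>
      x k \<in> U \<Longrightarrow> g (x (Suc k)) \<le> g (x k)"
    using U(4) unfolding d_lyapunov_on_def by blast
  obtain M where M: "M > 0" "\<And>x v. x \<in> cball xbar r \<Longrightarrow> v \<in> F x \<Longrightarrow> norm v \<le> M"
    using usc_bounded_on_compact[OF F_usc _ compact_cball] F_values by metis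
  \<comment> \<open>The three bounds serve the barrier, the monotonicity of \<open>g\<close>, and
    step lengths of at most \<open>r / 2\<close>: a step from the inner ball cannot leave
    \<open>cball xbar r\<close>.\<close>
  define amax where "amax = min (min h a0) (r / (2 * M))"
  have amax: "0 < amax" "amax \<le> h" "amax \<le> a0" "M * amax \<le> r / 2"
  proof -
    show "0 < amax" "amax \<le> h" "amax \<le> a0"
      using \<open>h > 0\<close> \<open>a0 > 0\<close> \<open>r > 0\<close> M by (auto simp: amax_def)
    have "M * amax \<le> M * (r / (2 * M))"
      using M by (intro mult_left_mono) (auto simp: amax_def)
    then show "M * amax \<le> r / 2" using M by simp
  qed
  have "(f \<longlongrightarrow> f xbar) (nhds xbar)" "(g \<longlongrightarrow> g xbar) (nhds xbar)"
    using f_cont[of UNIV] U continuous_on_eq_continuous_at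
    unfolding tendsto_at_iff_tendsto_nhds[symmetric] isCont_def[symmetric] by blast+
  then have "\<forall>\<^sub>F x in nhds xbar. f x < c" "\<forall>\<^sub>F x in nhds xbar. g x < ereal (gb + m / 2)"
    using c \<open>m > 0\<close> gb by (auto intro!: order_tendstoD(2))
  then obtain e where "e > 0"
      and e: "\<And>x. dist x xbar < e \<Longrightarrow> f x < c \<and> g x < ereal (gb + m / 2)"
    unfolding eventually_nhds_metric by (metis min_less_iff_conj)
  define \<delta> where "\<delta> = min e (r / 2)"
  have "\<delta> > 0" using \<open>e > 0\<close> \<open>r > 0\<close> by (simp add: \<delta>_def)
  have "range x \<subseteq> ball xbar \<epsilon>"
    if \<alpha>: "range \<alpha> \<subseteq> {0<..amax}" and traj: "discrete_trajectory F \<alpha> x" and x0: "x 0 \<in> ball xbar \<delta>"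
    for \<alpha> x
  proof -
    have \<alpha>_bd: "0 < \<alpha> k" "\<alpha> k \<le> amax" for k using \<alpha> by (auto simp: subset_iff)
    have "range \<alpha> \<subseteq> {0<..a0}" using \<alpha> amax by fastforce
    note lyap = lyap[OF this traj]
    have start: "f (x 0) < c" "g (x 0) < ereal (gb + m / 2)"
      using e[of "x 0"] x0 by (auto simp: \<delta>_def dist_commute)
    \<comment> \<open>Strong induction, because the barrier concerns the whole path from
      \<open>x 0\<close>: all earlier iterates must lie in \<open>cball xbar r\<close>.\<close>
    have in_ball: "x k \<in> ball xbar (r / 2) \<and> g (x k) \<le> g (x 0)" for k
    proof (induction k rule: less_induct)
      case (less n)
      show ?case
      proof (cases n)
        case 0
        then show ?thesis using x0 by (simp add: \<delta>_def)
      next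
        case (Suc k)
        have k: "x k \<in> ball xbar (r / 2)" "g (x k) \<le> g (x 0)" using less Suc by auto
        then have xk: "x k \<in> cball xbar r" using \<open>r > 0\<close> by auto
        then have "g (x n) \<le> g (x k)" unfolding Suc using lyap r by blast
        with k have g_le: "g (x n) \<le> g (x 0)" by simp
        obtain u where u: "u \<in> F (x k)" "x n = x k + \<alpha> k *\<^sub>R u"
          using traj unfolding discrete_trajectory_def Suc by blast
        have "norm (\<alpha> k *\<^sub>R u) \<le> amax * M"
          using \<alpha>_bd[of k] M(2)[OF xk u(1)] by (auto intro!: mult_mono)
        then have "dist (x k) (x n) \<le> r / 2"
          using amax u by (simp add: dist_norm mult.commute)
        then have xn: "x n \<in> cball xbar r"
          using k dist_triangle[of xbar "x n" "x k"] by simp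
        have "euler_path F (cball xbar r) h n \<alpha> x"
        proof (rule discrete_trajectory_euler_path[OF traj \<alpha>_bd(1)])
          show "x j \<in> cball xbar r" if "j \<le> n" for j
            using xn less[of j] that \<open>r > 0\<close> by (cases "j = n") auto
          show "\<alpha> j \<le> h" for j using \<alpha>_bd(2)[of j] amax by linarith
        qed
        then have "f (x n) < c'" using below start by (simp add: less_imp_le)
        moreover have "g (x n) < ereal (gb + m / 2)" using g_le start(2) by (rule le_less_trans)
        \<comment> \<open>The sum is below its values on the annulus, so \<open>x n\<close> must be
          back in the inner ball.\<close>
        ultimately have "?h (x n) < ereal (f xbar + gb + m)"
          using g_range[of "x n"] by (cases "g (x n)") (auto simp: c'_def)
        then have "x n \<notin> ?A" using m by fastforce
        with xn have "x n \<in> ball xbar (r / 2)" by blast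
        with g_le show ?thesis by blast
      qed
    qed
    have "x k \<in> cball xbar r" for k using in_ball[of k] \<open>r > 0\<close> by simp
    then show ?thesis using r by blast
  qed
  then show "\<exists>\<delta>>0. \<exists>\<alpha>max>0. \<forall>\<alpha> x. range \<alpha> \<subseteq> {0<..\<alpha>max} \<longrightarrow> discrete_trajectory F \<alpha> x \<longrightarrow>
      x 0 \<in> ball xbar \<delta> \<longrightarrow> range x \<subseteq> ball xbar \<epsilon>"
    using \<open>\<delta> > 0\<close> amax(1) by blast
qed

end
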